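(* Let $n\ge2$, let $(X_1,\dots,X_n)$ be a real random vector with finite second moments and centered joint distribution (each $X_k$ has mean $0$), with positive definite covariance matrix $R$, and let $i\ne j$ in $\{1,\dots,n\}$. Then $R^{-1}(i,j)=0$ if and only if the orthonormal polynomials associated with the moment matrix $M_1=\begin{pmatrix}1&0\\0&R\end{pmatrix}$ satisfy the conditional triangularity with respect to $(X_k)_{k\ne i,j}$.
   Context: $M_1$ is the matrix of moments $\mathbf{E}[uv]$ with $u,v$ running over the monomials $1,X_1,\dots,X_n$. Order the monomials of degree at most one as: $1$ first, then the variables $X_k$, $k\ne i,j$ (in some fixed order), then $X_i$, then $X_j$. The associated orthonormal polynomials are obtained from this ordered list by Gram–Schmidt for the inner product $\langle f,g\rangle=\mathbf{E}[fg]$ on polynomials of degree at most $1$: for each monomial $u$ in the list, $p_u=\sum_{v\text{ not after }u}\rho_{u,v}\,v$, the $p_u$ are orthonormal, and $\langle p_u,u\rangle>0$. Conditional triangularity with respect to $(X_k)_{k\ne i,j}$ (condition $(O)_1$): write each monomial as $u=X^{\alpha}Y^{\beta}$ with $X=(X_k)_{k\ne i,j}$, $Y=(X_i,X_j)$, $\alpha\in\mathbb{N}^{n-2}$, $\beta\in\mathbb{N}^2$. The condition is: whenever $u=X^\alpha Y^\beta$ and $v=X^{\alpha'}Y^{\beta'}$ are monomials of degree at most $1$ with $v$ not after $u$ in the order and $\beta'\not\le\beta$ (componentwise), one has $\rho_{u,v}=0$. *)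

theory Defs
  imports "HOL-Probability.Probability"
begin

section \<open>Covariance matrices\<close>

definition covariance_matrix :: "'a measure \<Rightarrow> ('a \<Rightarrow> real ^ 'n) \<Rightarrow> real ^ 'n ^ 'n" where
  "covariance_matrix M X =
     (\<chi> k l. \<integral>\<omega>. (X \<omega> $ k - (\<integral>\<omega>'. X \<omega>' $ k \<partial>M)) * (X \<omega> $ l - (\<integral>\<omega>'. X \<omega>' $ l \<partial>M)) \<partial>M)"

definition positive_definite :: "real ^ 'n ^ 'n \<Rightarrow> bool" where
  "positive_definite A \<longleftrightarrow> transpose A = A \<and> (\<forall>x. x \<noteq> 0 \<longrightarrow> 0 < x \<bullet> (A *v x))"

section \<open>Monomials and orthonormal polynomials\<close>

text \<open>A monomial is represented by its exponent vector; the variables are indexed by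
  the finite type \<^typ>\<open>'n\<close>.\<close>

type_synonym 'n exponents = "'n \<Rightarrow> nat"

definition mono_val :: "('n::finite) exponents \<Rightarrow> real ^ 'n \<Rightarrow> real" where
  "mono_val u x = (\<Prod>k\<in>UNIV. (x $ k) ^ u k)"

definition monos_upto :: "nat \<Rightarrow> ('n::finite) exponents set" where
  "monos_upto d = {u. (\<Sum>k\<in>UNIV. u k) \<le> d}"

definition one_mono :: "'n exponents" where
  "one_mono = (\<lambda>_. 0)"

definition var_mono :: "'n \<Rightarrow> 'n exponents" where
  "var_mono k = (\<lambda>l. if l = k then 1 else 0)"

text \<open>The inner product \<open>E[f g]\<close> and, for monomials, the entries of the moment matrix.\<close>

definition moment_inner ::
  "'a measure \<Rightarrow> ('a \<Rightarrow> real ^ 'n) \<Rightarrow> (real ^ 'n \<Rightarrow> real) \<Rightarrow> (real ^ 'n \<Rightarrow> real) \<Rightarrow> real" where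
  "moment_inner M X f g = (\<integral>\<omega>. f (X \<omega>) * g (X \<omega>) \<partial>M)"

definition moment_matrix ::
  "'a measure \<Rightarrow> ('a \<Rightarrow> real ^ 'n) \<Rightarrow> ('n::finite) exponents \<Rightarrow> 'n exponents \<Rightarrow> real" where
  "moment_matrix M X u v = moment_inner M X (mono_val u) (mono_val v)"

text \<open>An order on finitely many monomials is a list without repetitions;
  \<open>not_after us v u\<close> says that \<open>v\<close> does not come after \<open>u\<close> in it.\<close>

definition not_after :: "'b list \<Rightarrow> 'b \<Rightarrow> 'b \<Rightarrow> bool" where
  "not_after us v u \<longleftrightarrow> (\<exists>a<length us. \<exists>b\<le>a. us ! a = u \<and> us ! b = v)"

definition ordered_monos :: "'n list \<Rightarrow> 'n \<Rightarrow> 'n \<Rightarrow> 'n exponents list" where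
  "ordered_monos ks i j = one_mono # map var_mono ks @ [var_mono i, var_mono j]"

text \<open>The polynomial \<open>p\<^sub>u\<close> with coefficients \<open>\<rho> u v\<close>, for \<open>v\<close> not after \<open>u\<close>. The remaining
  values of \<open>\<rho>\<close> are irrelevant.\<close>

definition tri_poly ::
  "('n::finite) exponents list \<Rightarrow> ('n exponents \<Rightarrow> 'n exponents \<Rightarrow> real) \<Rightarrow>
   'n exponents \<Rightarrow> real ^ 'n \<Rightarrow> real" where
  "tri_poly us \<rho> u x = (\<Sum>v\<in>{v \<in> set us. not_after us v u}. \<rho> u v * mono_val v x)"

text \<open>\<open>\<rho>\<close> is the coefficient array of the Gram--Schmidt orthonormalisation of the list \<open>us\<close>.\<close>

definition orthonormal_coeffs ::
  "'a measure \<Rightarrow> ('a \<Rightarrow> real ^ 'n) \<Rightarrow> ('n::finite) exponents list \<Rightarrow>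
   ('n exponents \<Rightarrow> 'n exponents \<Rightarrow> real) \<Rightarrow> bool" where
  "orthonormal_coeffs M X us \<rho> \<longleftrightarrow>
     (\<forall>u\<in>set us. \<forall>v\<in>set us.
        moment_inner M X (tri_poly us \<rho> u) (tri_poly us \<rho> v) = (if u = v then 1 else 0)) \<and>
     (\<forall>u\<in>set us. 0 < moment_inner M X (tri_poly us \<rho> u) (mono_val u))"

text \<open>Conditional triangularity \<open>(O)\<^sub>d\<close> with respect to \<open>(X\<^sub>k)\<close>, \<open>k \<in> K\<close>. In
  \<open>u = X\<^sup>\<alpha> Y\<^sup>\<beta>\<close> the exponent \<open>\<beta>\<close> is the restriction of \<open>u\<close> to the complement of \<open>K\<close>.\<close>

definition conditionally_triangular ::
  "('n::finite) set \<Rightarrow> nat \<Rightarrow> 'n exponents list \<Rightarrow> ('n exponents \<Rightarrow> 'n exponents \<Rightarrow> real) \<Rightarrow> bool"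
where
  "conditionally_triangular K d us \<rho> \<longleftrightarrow>
     (\<forall>u\<in>monos_upto d. \<forall>v\<in>monos_upto d.
        not_after us v u \<and> \<not> (\<forall>k\<in>- K. v k \<le> u k) \<longrightarrow> \<rho> u v = 0)"

section \<open>Consistency of the definitions\<close>

lemma mono_val_one [simp]: "mono_val one_mono x = 1"
  by (simp add: mono_val_def one_mono_def)

lemma mono_val_var [simp]: "mono_val (var_mono k) x = x $ k"
proof -
  have "mono_val (var_mono k) x = (\<Prod>l\<in>UNIV. if l = k then x $ l else 1)"
    unfolding mono_val_def var_mono_def by (rule prod.cong) auto
  also have "\<dots> = x $ k" by (simp add: prod.delta)
  finally show ?thesis .
qed

lemma var_mono_eq [simp]: "var_mono k = var_mono l \<longleftrightarrow> k = l"
  by (auto simp: var_mono_def fun_eq_iff split: if_splits)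

lemma one_mono_neq [simp]: "one_mono \<noteq> var_mono k" "var_mono k \<noteq> one_mono"
  by (auto simp: var_mono_def one_mono_def fun_eq_iff)

lemma monos_upto_1: "monos_upto 1 = insert one_mono (range var_mono)"
proof (intro set_eqI iffI)
  fix u :: "'n::finite exponents"
  assume "u \<in> monos_upto 1"
  then have s: "(\<Sum>k\<in>UNIV. u k) \<le> 1" by (simp add: monos_upto_def)
  show "u \<in> insert one_mono (range var_mono)"
  proof (cases "u = one_mono")
    case False
    then obtain k where k: "u k \<noteq> 0" by (auto simp: one_mono_def)
    have "(\<Sum>k\<in>UNIV. u k) = u k + (\<Sum>l\<in>UNIV - {k}. u l)" by (simp add: sum.remove)
    with s k have "u k = 1" "(\<Sum>l\<in>UNIV - {k}. u l) = 0" by linarith+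
    then have "u = var_mono k" by (auto simp: var_mono_def)
    then show ?thesis by simp
  qed simp
qed (auto simp: monos_upto_def one_mono_def var_mono_def)

lemma set_ordered_monos:
  fixes i j :: "'n::finite"
  assumes "set ks = UNIV - {i, j}"
  shows "set (ordered_monos ks i j) = monos_upto 1"
  unfolding ordered_monos_def monos_upto_1 using assms by auto

lemma distinct_ordered_monos:
  assumes "i \<noteq> j" "distinct ks" "set ks = UNIV - {i, j}"
  shows "distinct (ordered_monos ks i j)"
proof -
  have inj: "inj_on var_mono (set ks)" by (rule inj_onI) simp
  have "i \<notin> set ks" "j \<notin> set ks" using assms(3) by auto
  then have "var_mono i \<notin> var_mono ` set ks" "var_mono j \<notin> var_mono ` set ks"
    by (metis imageE var_mono_eq)+
  moreover have "one_mono \<notin> var_mono ` set ks" by (metis imageE one_mono_neq(1))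
  moreover have "distinct (map var_mono ks)" using inj assms(2) by (simp only: distinct_map)
  ultimately show ?thesis using assms(1) by (simp add: ordered_monos_def)
qed

text \<open>For a centered vector the moment matrix of degree one is the block matrix with
  blocks \<open>1\<close> and \<open>R\<close>.\<close>

lemma moment_matrix_1:
  fixes X :: "'a \<Rightarrow> real ^ 'n::finite"
  assumes "prob_space M" "\<forall>k. (\<integral>\<omega>. X \<omega> $ k \<partial>M) = 0"
  shows "moment_matrix M X one_mono one_mono = 1"
    and "moment_matrix M X one_mono (var_mono k) = 0"
    and "moment_matrix M X (var_mono k) one_mono = 0"
    and "moment_matrix M X (var_mono k) (var_mono l) = covariance_matrix M X $ k $ l"
  using assms prob_space.prob_space[OF assms(1)]
  by (auto simp: moment_matrix_def moment_inner_def covariance_matrix_def)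

lemma gram_schmidt_coeffs_exist:
  fixes G :: "nat \<Rightarrow> nat \<Rightarrow> real" and N :: nat
  defines "B \<equiv> \<lambda>c d. \<Sum>a<N. \<Sum>b<N. c a * d b * G a b"
  assumes sym: "\<And>a b. G a b = G b a"
    and pd: "\<And>c a. a < N \<Longrightarrow> c a \<noteq> 0 \<Longrightarrow> 0 < B c c"
  shows "\<exists>r. (\<forall>a<N. \<forall>b>a. r a b = 0) \<and>
             (\<forall>a<N. \<forall>b<N. B (r a) (r b) = (if a = b then 1 else 0)) \<and>
             (\<forall>a<N. 0 < B (r a) (\<lambda>b. if b = a then 1 else 0))"
proof -
  have Bsym: "B c d = B d c" for c d
    unfolding B_def by (subst sum.swap) (simp add: sym mult.commute mult.left_commute)
  have Bdiff: "B (\<lambda>b. c b - d b) e = B c e - B d e" for c d e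
    unfolding B_def by (simp add: algebra_simps sum_subtractf)
  have Bscale: "B (\<lambda>b. s * c b) e = s * B c e" for s c e
    unfolding B_def by (simp add: sum_distrib_left mult.assoc)
  have B0: "B (\<lambda>b. 0) e = 0" for e unfolding B_def by simp
  have Badd: "B (\<lambda>b. c b + d b) e = B c e + B d e" for c d e
    unfolding B_def by (simp add: algebra_simps sum.distrib)
  have Bsum: "B (\<lambda>b. \<Sum>a<(m::nat). s a * r a b) e = (\<Sum>a<m. s a * B (r a) e)" for m s r e
    by (induction m) (simp_all add: B0 Badd Bscale)
  let ?e = "\<lambda>a b::nat. if b = a then 1 else (0::real)"
  have "\<exists>r. (\<forall>a<m. \<forall>b>a. r a b = 0) \<and>
             (\<forall>a<m. \<forall>b<m. B (r a) (r b) = (if a = b then 1 else 0)) \<and>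
             (\<forall>a<m. 0 < B (r a) (?e a))" if "m \<le> N" for m
    using that
  proof (induction m)
    case (Suc m)
    obtain r where r: "\<forall>a<m. \<forall>b>a. r a b = 0"
      "\<forall>a<m. \<forall>b<m. B (r a) (r b) = (if a = b then 1 else 0)"
      "\<forall>a<m. 0 < B (r a) (?e a)"
      using Suc.IH[OF Suc_leD[OF Suc.prems]] by blast
    have r1: "r a b = 0" if "a < m" "b > a" for a b using r(1) that by blast
    have r2: "B (r a) (r b) = (if a = b then 1 else 0)" if "a < m" "b < m" for a b
      using r(2) that by blast
    have r3: "0 < B (r a) (?e a)" if "a < m" for a using r(3) that by blast
    define s where "s a = B (?e m) (r a)" for a
    define q where "q b = ?e m b - (\<Sum>a<m. s a * r a b)" for b
    have Bq: "B q e = B (?e m) e - (\<Sum>a<m. s a * B (r a) e)" for e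
      unfolding q_def Bdiff Bsum ..
    have q0: "q b = 0" if "b > m" for b
      using that r1 by (auto simp: q_def intro!: sum.neutral)
    have qm: "q m = 1"
      using r1 by (auto simp: q_def intro!: sum.neutral)
    have qr: "B q (r a) = 0" if "a < m" for a
    proof -
      have "(\<Sum>a'<m. s a' * B (r a') (r a)) = (\<Sum>a'<m. if a' = a then s a' else 0)"
        using r2 that by (intro sum.cong) auto
      also have "\<dots> = s a" using that by (simp add: sum.delta)
      finally show ?thesis unfolding Bq by (simp add: s_def)
    qed
    have pos: "0 < B q q" using pd[of m q] qm Suc.prems by simp
    have "B q q = B (?e m) q - (\<Sum>a<m. s a * B (r a) q)" by (rule Bq)
    also have "(\<Sum>a<m. s a * B (r a) q) = 0"
      using qr Bsym[of _ q] by (intro sum.neutral) auto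
    finally have qe: "B q (?e m) = B q q" using Bsym[of q "?e m"] by simp
    define t where "t = 1 / sqrt (B q q)"
    have t: "t > 0" "t * (t * B q q) = 1"
      using pos by (simp_all add: t_def)
    define r' where "r' = r(m := \<lambda>b. t * q b)"
    have 1: "\<forall>a<Suc m. \<forall>b>a. r' a b = 0"
      using r1 q0 by (auto simp: r'_def less_Suc_eq)
    have tq: "B (\<lambda>b. t * q b) (\<lambda>b. t * q b) = 1"
      using t Bscale[of t q q] Bscale[of t q "\<lambda>b. t * q b"] Bsym[of q "\<lambda>b. t * q b"] by simp
    have tr: "B (\<lambda>b. t * q b) (r a) = 0" "B (r a) (\<lambda>b. t * q b) = 0" if "a < m" for a
      using Bscale[of t q "r a"] Bsym[of "r a" "\<lambda>b. t * q b"] qr[OF that] by simp_all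
    have 2: "\<forall>a<Suc m. \<forall>b<Suc m. B (r' a) (r' b) = (if a = b then 1 else 0)"
      using r2 tq tr by (auto simp: r'_def less_Suc_eq)
    have "0 < B (\<lambda>b. t * q b) (?e m)"
      using Bscale[of t q "?e m"] qe pos t by simp
    then have 3: "\<forall>a<Suc m. 0 < B (r' a) (?e a)"
      using r3 by (auto simp: r'_def less_Suc_eq)
    from 1 2 3 show ?case by blast
  qed simp
  from this[of N] show ?thesis by simp
qed

text \<open>The orthonormal polynomials exist.\<close>

lemma orthonormal_coeffs_exist:
  fixes X :: "'a \<Rightarrow> real ^ 'n::finite"
  assumes "prob_space M" "X \<in> borel_measurable M"
    and sq: "\<forall>k. integrable M (\<lambda>\<omega>. (X \<omega> $ k)\<^sup>2)"
    and cent: "\<forall>k. (\<integral>\<omega>. X \<omega> $ k \<partial>M) = 0"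
    and R: "positive_definite (covariance_matrix M X)"
    and us: "distinct us" "set us = monos_upto 1"
  shows "\<exists>\<rho>. orthonormal_coeffs M X us \<rho>"
proof -
  interpret prob_space M by fact
  have Xm: "(\<lambda>\<omega>. X \<omega> $ k) \<in> borel_measurable M" for k
    by (rule measurable_compose[OF assms(2)]) (intro borel_measurable_continuous_onI continuous_intros)
  have prod_int: "integrable M (\<lambda>\<omega>. f \<omega> * g \<omega>)"
    if "f \<in> borel_measurable M" "g \<in> borel_measurable M"
      "integrable M (\<lambda>\<omega>. (f \<omega>)\<^sup>2)" "integrable M (\<lambda>\<omega>. (g \<omega>)\<^sup>2)" for f g :: "'a \<Rightarrow> real"
  proof (rule Bochner_Integration.integrable_bound)
    show "integrable M (\<lambda>\<omega>. (f \<omega>)\<^sup>2 + (g \<omega>)\<^sup>2)" using that by simp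
    show "(\<lambda>\<omega>. f \<omega> * g \<omega>) \<in> borel_measurable M" using that by simp
    have "\<bar>a * b\<bar> \<le> a\<^sup>2 + b\<^sup>2" for a b :: real
    proof -
      have "2 * (\<bar>a\<bar> * \<bar>b\<bar>) \<le> \<bar>a\<bar>\<^sup>2 + \<bar>b\<bar>\<^sup>2" using sum_squares_bound[of "\<bar>a\<bar>" "\<bar>b\<bar>"] by simp
      moreover have "0 \<le> \<bar>a\<bar> * \<bar>b\<bar>" by simp
      ultimately show ?thesis unfolding abs_mult power2_abs by linarith
    qed
    then show "AE \<omega> in M. norm (f \<omega> * g \<omega>) \<le> norm ((f \<omega>)\<^sup>2 + (g \<omega>)\<^sup>2)"
      by simp
  qed
  have int: "integrable M (\<lambda>\<omega>. mono_val u (X \<omega>) * mono_val v (X \<omega>))"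
    if "u \<in> set us" "v \<in> set us" for u v
  proof (rule prod_int)
    show "(\<lambda>\<omega>. mono_val u (X \<omega>)) \<in> borel_measurable M"
      "(\<lambda>\<omega>. mono_val v (X \<omega>)) \<in> borel_measurable M"
      "integrable M (\<lambda>\<omega>. (mono_val u (X \<omega>))\<^sup>2)"
      "integrable M (\<lambda>\<omega>. (mono_val v (X \<omega>))\<^sup>2)"
      using that Xm sq unfolding us(2) monos_upto_1 by auto
  qed
  define N where "N = length us"
  define G where "G a b = moment_matrix M X (us ! a) (us ! b)" for a b
  define B where "B = (\<lambda>c d. \<Sum>a<N. \<Sum>b<N. c a * d b * G a b)"
  have bij: "bij_betw ((!) us) {..<N} (set us)"
    using us(1) by (simp add: N_def bij_betw_nth)
  define idx where "idx = the_inv_into {..<N} ((!) us)"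
  have idx [simp]: "idx (us ! a) = a" if "a < N" for a
    using that bij unfolding idx_def bij_betw_def by (simp add: the_inv_into_f_f)
  have inner: "moment_inner M X (\<lambda>x. \<Sum>a<N. c a * mono_val (us ! a) x)
                 (\<lambda>x. \<Sum>b<N. d b * mono_val (us ! b) x) = B c d" for c d
  proof -
    have "moment_inner M X (\<lambda>x. \<Sum>a<N. c a * mono_val (us ! a) x)
            (\<lambda>x. \<Sum>b<N. d b * mono_val (us ! b) x) =
          (\<integral>\<omega>. (\<Sum>a<N. \<Sum>b<N. c a * d b * (mono_val (us ! a) (X \<omega>) * mono_val (us ! b) (X \<omega>))) \<partial>M)"
      unfolding moment_inner_def sum_product
      by (intro Bochner_Integration.integral_cong sum.cong refl) (simp add: ac_simps)
    also have "\<dots> = B c d"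
    proof -
      have I: "integrable M (\<lambda>\<omega>. c a * d b * (mono_val (us ! a) (X \<omega>) * mono_val (us ! b) (X \<omega>)))"
        if "a < N" "b < N" for a b
        using int[of "us ! a" "us ! b"] that by (simp add: N_def)
      then have J: "integrable M (\<lambda>\<omega>. \<Sum>b<N. c a * d b * (mono_val (us ! a) (X \<omega>) * mono_val (us ! b) (X \<omega>)))"
        if "a < N" for a using that by (intro Bochner_Integration.integrable_sum) auto
      have "(\<integral>\<omega>. (\<Sum>b<N. c a * d b * (mono_val (us ! a) (X \<omega>) * mono_val (us ! b) (X \<omega>))) \<partial>M) =
          (\<Sum>b<N. c a * d b * G a b)" if "a < N" for a
        using I that
        by (subst Bochner_Integration.integral_sum) (simp_all add: G_def moment_matrix_def moment_inner_def)
      then show ?thesis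
        unfolding B_def using J by (subst Bochner_Integration.integral_sum) simp_all
    qed
    finally show ?thesis .
  qed
  have pd: "0 < B c c" if "a < N" "c a \<noteq> 0" for c a
  proof -
    define d where "d u = c (idx u)" for u
    define y :: "real ^ 'n" where "y = (\<chi> k. d (var_mono k))"
    have S: "(\<Sum>u\<in>set us. f u) = f one_mono + (\<Sum>k\<in>UNIV. f (var_mono k))" for f :: "_ \<Rightarrow> real"
      unfolding us(2) monos_upto_1
      by (subst sum.insert) (auto simp: sum.reindex inj_on_def)
    have re: "(\<Sum>a<N. g a) = (\<Sum>u\<in>set us. g (idx u))" for g :: "_ \<Rightarrow> real"
      using sum.reindex_bij_betw[OF bij, of "\<lambda>u. g (idx u)"] by simp
    have ni: "us ! idx u = u" if "u \<in> set us" for u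
      using that by (auto simp: in_set_conv_nth N_def[symmetric])
    have "B c c = (\<Sum>u\<in>set us. \<Sum>v\<in>set us. d u * d v * moment_matrix M X u v)"
      unfolding B_def re G_def d_def using ni by (intro sum.cong refl) simp
    also have "\<dots> = (d one_mono)\<^sup>2 +
        (\<Sum>k\<in>UNIV. \<Sum>l\<in>UNIV. d (var_mono k) * d (var_mono l) * covariance_matrix M X $ k $ l)"
      unfolding S by (simp add: moment_matrix_1[OF assms(1) cent] power2_eq_square)
    also have "(\<Sum>k\<in>UNIV. \<Sum>l\<in>UNIV. d (var_mono k) * d (var_mono l) * covariance_matrix M X $ k $ l)
        = y \<bullet> (covariance_matrix M X *v y)"
      by (simp add: inner_vec_def matrix_vector_mult_def y_def sum_distrib_left ac_simps)
    finally have eq: "B c c = (d one_mono)\<^sup>2 + y \<bullet> (covariance_matrix M X *v y)" .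
    show ?thesis
    proof (cases "y = 0")
      case True
      have "d (us ! a) \<noteq> 0" using that by (simp add: d_def)
      moreover have "us ! a \<in> insert one_mono (range var_mono)"
        using that us(2) by (metis N_def nth_mem monos_upto_1)
      moreover have "d (var_mono k) = 0" for k using True by (simp add: y_def vec_eq_iff)
      ultimately have "d one_mono \<noteq> 0" by auto
      then show ?thesis unfolding eq True by simp
    next
      case False
      then have "0 < y \<bullet> (covariance_matrix M X *v y)"
        using R by (simp add: positive_definite_def)
      then show ?thesis unfolding eq by (simp add: add_nonneg_pos)
    qed
  qed
  have Gsym: "G a b = G b a" for a b
    by (simp add: G_def moment_matrix_def moment_inner_def mult.commute)
  have "\<exists>r. (\<forall>a<N. \<forall>b>a. r a b = 0) \<and>
             (\<forall>a<N. \<forall>b<N. B (r a) (r b) = (if a = b then 1 else 0)) \<and>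
             (\<forall>a<N. 0 < B (r a) (\<lambda>b. if b = a then 1 else 0))"
    unfolding B_def
    by (rule gram_schmidt_coeffs_exist[of G N, OF Gsym]) (use pd in \<open>simp_all add: B_def\<close>)
  then obtain r where r: "\<forall>a<N. \<forall>b>a. r a b = 0"
    "\<forall>a<N. \<forall>b<N. B (r a) (r b) = (if a = b then 1 else 0)"
    "\<forall>a<N. 0 < B (r a) (\<lambda>b. if b = a then 1 else 0)"
    by blast
  have r1: "r a b = 0" if "a < N" "b > a" for a b using r(1) that by blast
  have r2: "B (r a) (r b) = (if a = b then 1 else 0)" if "a < N" "b < N" for a b
    using r(2) that by blast
  have r3: "0 < B (r a) (\<lambda>b. if b = a then 1 else 0)" if "a < N" for a
    using r(3) that by blast
  define \<rho> where "\<rho> u v = r (idx u) (idx v)" for u v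
  have tri: "tri_poly us \<rho> (us ! a) = (\<lambda>x. \<Sum>b<N. r a b * mono_val (us ! b) x)" if a: "a < N" for a
  proof
    fix x
    have "{v \<in> set us. not_after us v (us ! a)} = (!) us ` {..a}"
      using a us(1) by (force simp: not_after_def N_def nth_eq_iff_index_eq)
    then have "tri_poly us \<rho> (us ! a) x = (\<Sum>v\<in>(!) us ` {..a}. \<rho> (us ! a) v * mono_val v x)"
      by (simp add: tri_poly_def)
    also have "\<dots> = (\<Sum>b\<le>a. r a b * mono_val (us ! b) x)"
      using a us(1)
      by (subst sum.reindex) (auto simp: inj_on_def nth_eq_iff_index_eq N_def[symmetric] \<rho>_def)
    also have "\<dots> = (\<Sum>b<N. r a b * mono_val (us ! b) x)"
      using a r1 by (intro sum.mono_neutral_left) auto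
    finally show "tri_poly us \<rho> (us ! a) x = (\<Sum>b<N. r a b * mono_val (us ! b) x)" .
  qed
  have mv: "mono_val (us ! a) = (\<lambda>x. \<Sum>b<N. (if b = a then 1 else 0) * mono_val (us ! b) x)"
    if "a < N" for a
  proof
    fix x
    have "(\<Sum>b<N. (if b = a then 1 else 0) * mono_val (us ! b) x) =
          (\<Sum>b<N. if b = a then mono_val (us ! b) x else 0)" by (intro sum.cong) auto
    then show "mono_val (us ! a) x = (\<Sum>b<N. (if b = a then 1 else 0) * mono_val (us ! b) x)"
      using that by (simp add: sum.delta)
  qed
  have o1: "moment_inner M X (tri_poly us \<rho> (us ! a)) (tri_poly us \<rho> (us ! b)) =
      (if us ! a = us ! b then 1 else 0)" if "a < N" "b < N" for a b
    using that us(1) by (simp add: tri inner r2 nth_eq_iff_index_eq N_def[symmetric])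
  have o2: "0 < moment_inner M X (tri_poly us \<rho> (us ! a)) (mono_val (us ! a))" if "a < N" for a
    unfolding tri[OF that] by (subst mv[OF that]) (simp only: inner r3[OF that])
  have "orthonormal_coeffs M X us \<rho>"
    unfolding orthonormal_coeffs_def
  proof (intro conjI ballI)
    fix u v assume "u \<in> set us" "v \<in> set us"
    then obtain a b where "a < N" "us ! a = u" "b < N" "us ! b = v"
      by (auto simp: in_set_conv_nth N_def)
    with o1[of a b] show
      "moment_inner M X (tri_poly us \<rho> u) (tri_poly us \<rho> v) = (if u = v then 1 else 0)" by simp
  next
    fix u assume "u \<in> set us"
    then obtain a where "a < N" "us ! a = u" by (auto simp: in_set_conv_nth N_def)
    with o2[of a] show "0 < moment_inner M X (tri_poly us \<rho> u) (mono_val u)" by simp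
  qed
  then show ?thesis by (rule exI[of _ \<rho>])
qed

end

theory Submission
  imports Defs
begin

text \<open>By triangularity and orthonormality, the last polynomial
  \<open>p = c\<^sub>0 + (\<Sum>k. c\<^sub>k X\<^sub>k)\<close>, with leading monomial \<open>X\<^sub>j\<close>, is orthogonal to every other monomial but
  not to \<open>X\<^sub>j\<close>. As the \<open>X\<^sub>k\<close> are centered, this says \<open>R c = s e\<^sub>j\<close> with \<open>s \<noteq> 0\<close>, so
  \<open>c\<^sub>i = s R\<^sup>-\<^sup>1(i, j)\<close>. On the other hand, the only pair of monomials on which conditional triangularity
  is not vacuous is \<open>(X\<^sub>j, X\<^sub>i)\<close>, where it reads \<open>c\<^sub>i = 0\<close>.\<close>

lemma integrable_mult_of_squares:
  fixes f g :: "'a \<Rightarrow> real"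
  assumes [measurable]: "f \<in> borel_measurable M" "g \<in> borel_measurable M"
    and sq: "integrable M (\<lambda>\<omega>. (f \<omega>)\<^sup>2)" "integrable M (\<lambda>\<omega>. (g \<omega>)\<^sup>2)"
  shows "integrable M (\<lambda>\<omega>. f \<omega> * g \<omega>)"
proof (rule Bochner_Integration.integrable_bound)
  show "integrable M (\<lambda>\<omega>. (f \<omega>)\<^sup>2 + (g \<omega>)\<^sup>2)"
    using sq by simp
  have "\<bar>a * b\<bar> \<le> a\<^sup>2 + b\<^sup>2" for a b :: real
  proof -
    have "0 \<le> \<bar>a\<bar> * \<bar>b\<bar>" by simp
    then show ?thesis
      using sum_squares_bound[of "\<bar>a\<bar>" "\<bar>b\<bar>"] unfolding abs_mult power2_abs by linarith
  qed
  then show "AE \<omega> in M. norm (f \<omega> * g \<omega>) \<le> norm ((f \<omega>)\<^sup>2 + (g \<omega>)\<^sup>2)"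
    by simp
qed measurable

text \<open>In degree at most one a monomial is the constant 1, square integrable because the
  measure is finite, or a coordinate, square integrable by \<open>sq\<close>. Every entry of the
  moment matrix is therefore a genuine integral.\<close>

lemma integrable_mono_val_mult:
  fixes X :: "'a \<Rightarrow> real ^ 'n::finite"
  assumes "prob_space M" and X: "X \<in> borel_measurable M"
    and sq: "\<forall>k. integrable M (\<lambda>\<omega>. (X \<omega> $ k)\<^sup>2)"
    and uv: "u \<in> monos_upto 1" "v \<in> monos_upto 1"
  shows "integrable M (\<lambda>\<omega>. mono_val u (X \<omega>) * mono_val v (X \<omega>))"
proof -
  interpret prob_space M by fact
  have "(\<lambda>\<omega>. X \<omega> $ k) \<in> borel_measurable M" for k
    by (rule measurable_compose[OF X])
      (intro borel_measurable_continuous_onI continuous_intros)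
  then show ?thesis
    using uv sq unfolding monos_upto_1
    by (intro integrable_mult_of_squares) auto
qed

lemma moment_inner_commute: "moment_inner M X f g = moment_inner M X g f"
  by (simp add: moment_inner_def mult.commute)

lemma integrable_mult_tri_poly:
  assumes "\<And>v. v \<in> set us \<Longrightarrow> integrable M (\<lambda>\<omega>. f (X \<omega>) * mono_val v (X \<omega>))"
  shows "integrable M (\<lambda>\<omega>. f (X \<omega>) * tri_poly us \<rho> u (X \<omega>))"
  unfolding tri_poly_def sum_distrib_left mult.left_commute[of "f _"]
  using assms by auto

lemma moment_inner_tri_poly_right:
  assumes "\<And>v. v \<in> set us \<Longrightarrow> integrable M (\<lambda>\<omega>. f (X \<omega>) * mono_val v (X \<omega>))"
  shows "moment_inner M X f (tri_poly us \<rho> u) =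
    (\<Sum>v\<in>{v \<in> set us. not_after us v u}. \<rho> u v * moment_inner M X f (mono_val v))"
  unfolding moment_inner_def tri_poly_def sum_distrib_left mult.left_commute[of "f _"]
  using assms by (subst Bochner_Integration.integral_sum) auto

text \<open>Replaces the order on monomials by the order on list positions, so that the coefficient
  sums become sums over an initial segment of indices, suited to induction.\<close>

lemma not_after_nth:
  assumes "distinct us" "a < length us"
  shows "{v \<in> set us. not_after us v (us ! a)} = (!) us ` {..a}"
  using assms by (force simp: not_after_def nth_eq_iff_index_eq)

context
  fixes M :: "'a measure" and X :: "'a \<Rightarrow> real ^ 'n::finite"
    and us :: "'n exponents list" and \<rho> :: "'n exponents \<Rightarrow> 'n exponents \<Rightarrow> real"
  assumes us: "distinct us"
    and integrable: "\<And>u v. u \<in> set us \<Longrightarrow> v \<in> set us \<Longrightarrow>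
      integrable M (\<lambda>\<omega>. mono_val u (X \<omega>) * mono_val v (X \<omega>))"
    and ortho: "orthonormal_coeffs M X us \<rho>"
begin

lemma moment_inner_tri_poly_nth:
  assumes "a < length us"
  shows "moment_inner M X (tri_poly us \<rho> w) (tri_poly us \<rho> (us ! a)) =
    (\<Sum>b\<le>a. \<rho> (us ! a) (us ! b) * moment_inner M X (tri_poly us \<rho> w) (mono_val (us ! b)))"
proof -
  have "integrable M (\<lambda>\<omega>. tri_poly us \<rho> w (X \<omega>) * mono_val v (X \<omega>))" if "v \<in> set us" for v
    using integrable_mult_tri_poly[of us M "mono_val v" X \<rho> w] integrable that
    by (simp add: mult.commute)
  moreover have "inj_on ((!) us) {..a}"
    using assms us by (auto intro!: inj_onI simp: nth_eq_iff_index_eq)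
  ultimately show ?thesis
    using assms us by (simp add: moment_inner_tri_poly_right not_after_nth sum.reindex)
qed

text \<open>Triangularity is inverted without solving for the monomials: in the expansion of the
  inner product of \<open>p\<^sub>c\<close> and \<open>p\<^sub>b\<close> with
  \<open>b \<le> c\<close>, the monomials before position \<open>b\<close> contribute 0 by
  induction, and only the leading term of \<open>p\<^sub>b\<close> survives. Both claims go through
  one induction because the first shows that the coefficient to be cancelled in the second is
  nonzero.\<close>

lemma
  assumes "b < length us"
  shows tri_poly_leading: "\<rho> (us ! b) (us ! b) *
      moment_inner M X (tri_poly us \<rho> (us ! b)) (mono_val (us ! b)) = 1"
    and tri_poly_orthogonal: "b < c \<Longrightarrow> c < length us \<Longrightarrow>
      moment_inner M X (tri_poly us \<rho> (us ! c)) (mono_val (us ! b)) = 0"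
proof -
  let ?p = "\<lambda>a. tri_poly us \<rho> (us ! a)" and ?m = "\<lambda>a. mono_val (us ! a)"
  have "\<rho> (us ! b) (us ! b) * moment_inner M X (?p b) (?m b) = 1 \<and>
    (\<forall>c. b < c \<longrightarrow> c < length us \<longrightarrow> moment_inner M X (?p c) (?m b) = 0)"
    using assms
  proof (induction b rule: less_induct)
    case (less b)
    \<comment> \<open>The case \<open>c = b\<close> is included: it gives the leading term, while
      \<open>b < c\<close> gives orthogonality.\<close>
    have top: "moment_inner M X (?p c) (?p b) =
        \<rho> (us ! b) (us ! b) * moment_inner M X (?p c) (?m b)"
      if c: "b \<le> c" "c < length us" for c
    proof -
      have "moment_inner M X (?p c) (?m a) = 0" if "a < b" for a
        using less.IH[OF that] that c by simp
      then have "(\<Sum>a<b. \<rho> (us ! b) (us ! a) * moment_inner M X (?p c) (?m a)) = 0"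
        by simp
      then show ?thesis
        using less.prems by (simp add: moment_inner_tri_poly_nth lessThan_Suc_atMost[symmetric])
    qed
    have pp: "moment_inner M X (?p c) (?p b) = (if c = b then 1 else 0)" if "c < length us" for c
      using ortho less.prems that us by (simp add: orthonormal_coeffs_def nth_eq_iff_index_eq)
    have 1: "\<rho> (us ! b) (us ! b) * moment_inner M X (?p b) (?m b) = 1"
      using top[of b] pp[of b] less.prems by simp
    have "moment_inner M X (?p c) (?m b) = 0" if "b < c" "c < length us" for c
      using top[of c] pp[of c] that 1 by auto
    with 1 show ?case by blast
  qed
  then show "\<rho> (us ! b) (us ! b) * moment_inner M X (?p b) (?m b) = 1"
    and "b < c \<Longrightarrow> c < length us \<Longrightarrow> moment_inner M X (?p c) (?m b) = 0"
    by blast+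
qed

end

text \<open>The exponents at \<open>i\<close> and \<open>j\<close> of \<open>v\<close> can exceed
  those of \<open>u\<close> only if \<open>v\<close> is one of the last two monomials. Then
  \<open>u\<close>, which does not precede \<open>v\<close>, is also one of them and differs from
  \<open>v\<close>, so the order leaves a single pair.\<close>

lemma conditionally_triangular_ordered_monos_iff:
  fixes i j :: "'n::finite"
  assumes "i \<noteq> j" "distinct ks" "set ks = UNIV - {i, j}"
  shows "conditionally_triangular (UNIV - {i, j}) 1 (ordered_monos ks i j) \<rho> \<longleftrightarrow>
    \<rho> (var_mono j) (var_mono i) = 0"
proof -
  let ?us = "ordered_monos ks i j" and ?n = "length ks"
  \<comment> \<open>The constant sits at position 0 and \<open>ks\<close> fills positions 1 to
    \<open>?n\<close>, so the two distinguished variables come at \<open>?n + 1\<close> and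
    \<open>?n + 2\<close>.\<close>
  have len: "length ?us = ?n + 3" by (simp add: ordered_monos_def)
  have nth: "?us ! (?n + 1) = var_mono i" "?us ! (?n + 2) = var_mono j"
    by (simp_all add: ordered_monos_def nth_append)
  have dist: "distinct ?us" by (rule distinct_ordered_monos[OF assms])
  have ij: "not_after ?us (var_mono i) (var_mono j)"
    unfolding not_after_def using len nth
    by (intro exI[of _ "?n + 2"] conjI exI[of _ "?n + 1"]) auto
  have ji: "\<not> not_after ?us (var_mono j) (var_mono i)"
  proof
    assume "not_after ?us (var_mono j) (var_mono i)"
    then obtain a b where ab: "a < length ?us" "b \<le> a" "?us ! a = var_mono i" "?us ! b = var_mono j"
      by (auto simp: not_after_def)
    then have "a = ?n + 1" "b = ?n + 2"
      using nth len dist nth_eq_iff_index_eq[of ?us a "?n + 1"] nth_eq_iff_index_eq[of ?us b "?n + 2"]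
      by auto
    then show False using ab by simp
  qed
  have early: "u = var_mono i \<or> u = var_mono j"
    if na: "not_after ?us v u" and v: "v = var_mono i \<or> v = var_mono j" for u v
  proof -
    from na obtain a b where ab: "a < length ?us" "b \<le> a" "?us ! a = u" "?us ! b = v"
      by (auto simp: not_after_def)
    then have "b = ?n + 1 \<or> b = ?n + 2"
      using v nth len dist
        nth_eq_iff_index_eq[of ?us b "?n + 1"] nth_eq_iff_index_eq[of ?us b "?n + 2"]
      by auto
    then have "a = ?n + 1 \<or> a = ?n + 2" using ab len by auto
    then show ?thesis using ab nth by auto
  qed
  have exp: "(\<forall>k\<in>- (UNIV - {i, j}). v k \<le> u k) \<longleftrightarrow> v i \<le> u i \<and> v j \<le> u j" for u v :: "'n exponents"
    by auto
  show ?thesis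
  proof
    assume ct: "conditionally_triangular (UNIV - {i, j}) 1 ?us \<rho>"
    have "\<not> (\<forall>k\<in>- (UNIV - {i, j}). var_mono i k \<le> var_mono j k)"
      using assms(1) by (simp add: exp var_mono_def)
    moreover have "var_mono j \<in> monos_upto 1" "var_mono i \<in> monos_upto 1"
      unfolding monos_upto_1 by auto
    ultimately show "\<rho> (var_mono j) (var_mono i) = 0"
      using ct ij unfolding conditionally_triangular_def by blast
  next
    assume 0: "\<rho> (var_mono j) (var_mono i) = 0"
    show "conditionally_triangular (UNIV - {i, j}) 1 ?us \<rho>"
      unfolding conditionally_triangular_def exp
    proof (intro ballI impI)
      fix u v :: "'n exponents"
      assume v: "v \<in> monos_upto 1" and uv: "not_after ?us v u \<and> \<not> (v i \<le> u i \<and> v j \<le> u j)"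
      \<comment> \<open>The constant and the variables in \<open>ks\<close> have exponent 0 at both
        \<open>i\<close> and \<open>j\<close>, so they cannot violate the componentwise
        inequality.\<close>
      then have "v \<noteq> one_mono" "\<And>k. v = var_mono k \<Longrightarrow> k = i \<or> k = j"
        by (auto simp: one_mono_def var_mono_def split: if_splits)
      then have vij: "v = var_mono i \<or> v = var_mono j"
        using v unfolding monos_upto_1 by auto
      then have "u = var_mono i \<or> u = var_mono j" using early uv by blast
      moreover have "u \<noteq> v" using uv by auto
      ultimately show "\<rho> u v = 0" using vij uv ji 0 by auto
    qed
  qed
qed

text \<open>A kernel vector makes the quadratic form vanish, so the kernel is trivial and the square
  matrix is invertible. Since \<open>matrix_inv\<close> is a choice of two-sided inverse, existence
  has to come first.\<close>

lemma matrix_inv_mult_positive_definite: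
  fixes A :: "real ^ 'n ^ 'n"
  assumes "positive_definite A"
  shows "matrix_inv A ** A = mat 1"
proof -
  have "x = 0" if "A *v x = 0" for x
    using assms that unfolding positive_definite_def by force
  then have "invertible A"
    using invertible_left_inverse matrix_left_invertible_ker by blast
  then show ?thesis
    unfolding invertible_def matrix_inv_def by (rule someI2_ex) simp
qed

theorem corollary6p2:
  fixes M :: "'a measure"
    and X :: "'a \<Rightarrow> real ^ 'n::finite"
    and i j :: 'n
    and ks :: "'n list"
    and \<rho> :: "'n exponents \<Rightarrow> 'n exponents \<Rightarrow> real"
  assumes "prob_space M"
    and "2 \<le> CARD('n)"
    and "X \<in> borel_measurable M"
    and "\<forall>k. integrable M (\<lambda>\<omega>. (X \<omega> $ k)\<^sup>2)"
    and "\<forall>k. (\<integral>\<omega>. X \<omega> $ k \<partial>M) = 0"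
    and "positive_definite (covariance_matrix M X)"
    and "i \<noteq> j"
    and "distinct ks" and "set ks = UNIV - {i, j}"
    and "orthonormal_coeffs M X (ordered_monos ks i j) \<rho>"
  shows "matrix_inv (covariance_matrix M X) $ i $ j = 0 \<longleftrightarrow>
         conditionally_triangular (UNIV - {i, j}) 1 (ordered_monos ks i j) \<rho>"
proof -
  let ?R = "covariance_matrix M X" and ?us = "ordered_monos ks i j"
  have dist: "distinct ?us" by (rule distinct_ordered_monos[OF assms(7-9)])
  have set: "set ?us = monos_upto 1" by (rule set_ordered_monos[OF assms(9)])
  have int: "integrable M (\<lambda>\<omega>. mono_val u (X \<omega>) * mono_val v (X \<omega>))"
    if "u \<in> set ?us" "v \<in> set ?us" for u v
    using integrable_mono_val_mult[OF assms(1,3,4)] that set by simp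
  note ortho = tri_poly_leading[OF dist int assms(10)] tri_poly_orthogonal[OF dist int assms(10)]
  let ?N = "length ks + 2"
  have N: "?N < length ?us" "length ?us = Suc ?N" "?us ! ?N = var_mono j"
    by (simp_all add: ordered_monos_def nth_append)
  let ?p = "tri_poly ?us \<rho> (var_mono j)"
  \<comment> \<open>The constant coefficient of \<open>?p\<close> can be left out of
    \<open>c\<close>: its pairing with each coordinate vanishes by centering.\<close>
  define c :: "real ^ 'n" where "c = (\<chi> k. \<rho> (var_mono j) (var_mono k))"
  define s where "s = moment_inner M X ?p (mono_val (var_mono j))"
  \<comment> \<open>The product of \<open>s\<close> with the leading coefficient of
    \<open>?p\<close> is 1.\<close>
  have s: "s \<noteq> 0"
    using ortho(1)[OF _ _ N(1)] unfolding N(3) s_def by auto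
  have orth: "moment_inner M X ?p (mono_val (var_mono l)) = 0" if "l \<noteq> j" for l
  proof -
    have "var_mono l \<in> set ?us" unfolding set monos_upto_1 by simp
    then obtain b where b: "b < length ?us" "?us ! b = var_mono l"
      by (auto simp: in_set_conv_nth)
    with N that have "b < ?N" by (metis less_SucE var_mono_eq)
    from ortho(2)[OF _ _ b(1) this N(1)] show ?thesis unfolding b(2) N(3) .
  qed
  \<comment> \<open>As \<open>var_mono j\<close> is last in the list, \<open>?p\<close> involves
    every monomial of degree at most one, and the vector \<open>c\<close> has no missing
    entries.\<close>
  have all: "{v \<in> set ?us. not_after ?us v (var_mono j)} = insert one_mono (range var_mono)"
  proof -
    have "not_after ?us v (var_mono j)" if "v \<in> set ?us" for v
      unfolding not_after_def using that N by (metis in_set_conv_nth less_Suc_eq_le)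
    then show ?thesis using set unfolding monos_upto_1 by blast
  qed
  have "moment_inner M X ?p (mono_val (var_mono l)) = (?R *v c) $ l" for l
  proof -
    have "var_mono l \<in> set ?us" unfolding set monos_upto_1 by simp
    then have "moment_inner M X (mono_val (var_mono l)) ?p =
        (\<Sum>v\<in>insert one_mono (range var_mono). \<rho> (var_mono j) v * moment_matrix M X (var_mono l) v)"
      unfolding all[symmetric] moment_matrix_def by (intro moment_inner_tri_poly_right int)
    also have "\<dots> = (\<Sum>k\<in>UNIV. \<rho> (var_mono j) (var_mono k) * ?R $ l $ k)"
      by (subst sum.insert)
        (auto simp: sum.reindex inj_on_def moment_matrix_1[OF assms(1,5)])
    also have "\<dots> = (?R *v c) $ l"
      by (simp add: matrix_vector_mult_def c_def mult.commute)
    finally show ?thesis by (simp add: moment_inner_commute)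
  qed
  then have "?R *v c = s *\<^sub>R axis j 1"
    using orth by (auto simp: vec_eq_iff axis_def s_def)
  then have "matrix_inv ?R *v (?R *v c) = s *\<^sub>R (matrix_inv ?R *v axis j 1)"
    by (simp add: matrix_vector_mult_scaleR)
  moreover have "matrix_inv ?R *v (?R *v c) = c"
    by (simp add: matrix_vector_mul_assoc matrix_inv_mult_positive_definite[OF assms(6)])
  \<comment> \<open>Applying the inverse to a multiple of the basis vector at \<open>j\<close> picks
    out column \<open>j\<close>; its entry at \<open>i\<close> is the one in question.\<close>
  ultimately have "c $ i = s * matrix_inv ?R $ i $ j"
    by (simp add: matrix_vector_mult_basis column_def)
  then have "matrix_inv ?R $ i $ j = 0 \<longleftrightarrow> \<rho> (var_mono j) (var_mono i) = 0"
    using s by (simp add: c_def)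
  then show ?thesis
    using conditionally_triangular_ordered_monos_iff[OF assms(7-9)] by simp
qed

end
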